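(* For every $m\ge 3$, $$d([f_{m+4}-1,\ldots,f_{m+5}-2])=d([f_{m+2}-1,\ldots,f_{m+3}-2,f_{m+3}-1,\ldots,f_{m+4}-2])+[\underbrace{0,\ldots,0}_{f_{m-1}+1},\underbrace{1,\ldots,1}_{f_m-1},\underbrace{0,\ldots,0}_{f_{m+2}}].$$
   Context: The Fibonacci sequence $\mathbb{F}$ is the infinite word over $\{a,b\}$ that is the fixed point beginning with $a$ of the morphism $\sigma(a)=ab$, $\sigma(b)=a$; $\mathbb{F}[1,n]$ is its prefix of length $n$. For a nonempty factor $\omega$ of $\mathbb{F}$, $\omega_p$ denotes its $p$-th occurrence in $\mathbb{F}$; $\omega_p\omega_{p+1}\omega_{p+2}$ is a cube occurrence when these three consecutive occurrences of $\omega$ are adjacent (each starts right after the previous one ends). $d(n)=\sharp\{(\omega,p):\omega_p\omega_{p+1}\omega_{p+2}\triangleright\mathbb{F}[1,n]\}$ is the number of cube occurrences that end at position $n$ (i.e. are a suffix of $\mathbb{F}[1,n]$). For a vector of integers, $d([n_1,\ldots,n_k])=[d(n_1),\ldots,d(n_k)]$; vectors written with ranges contain all consecutive integers in those ranges, and $+$ is componentwise addition. The Fibonacci numbers are indexed by $f_{-2}=0$, $f_{-1}=1$, $f_{m+1}=f_m+f_{m-1}$ for $m\ge -1$ (so $f_0=1$, $f_1=2$, $f_2=3$). *)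

theory Defs
  imports "HOL-Library.Stream" "HOL-Number_Theory.Fib"
begin

section \<open>The Fibonacci word\<close>

datatype letter = La | Lb

fun sigma :: "letter \<Rightarrow> letter list" where
  "sigma La = [La, Lb]"
| "sigma Lb = [La]"

definition sigma_stream :: "letter stream \<Rightarrow> letter stream" where
  "sigma_stream s = flat (smap sigma s)"

definition fibword :: "letter stream" where
  "fibword = (THE s. sigma_stream s = s \<and> shd s = La)"

definition sigma_list :: "letter list \<Rightarrow> letter list" where
  "sigma_list w = concat (map sigma w)"

lemma sigma_nonempty [simp]: "sigma c \<noteq> []"
  by (cases c) auto

lemma sigma_list_append: "sigma_list (u @ v) = sigma_list u @ sigma_list v"
  by (simp add: sigma_list_def)

lemma length_sigma_list: "length w \<le> length (sigma_list w)"
proof (induction w)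
  case (Cons c w)
  then show ?case by (cases c) (auto simp: sigma_list_def)
qed (simp add: sigma_list_def)

lemma sigma_stream_shift: "sigma_stream (w @- s) = sigma_list w @- sigma_stream s"
  by (induction w) (simp_all add: sigma_stream_def sigma_list_def)

lemma iterate_extends: "\<exists>r. r \<noteq> [] \<and> (sigma_list ^^ Suc k) [La] = (sigma_list ^^ k) [La] @ r"
proof (induction k)
  case 0
  show ?case by (simp add: sigma_list_def)
next
  case (Suc k)
  then obtain r where r: "r \<noteq> []" "(sigma_list ^^ Suc k) [La] = (sigma_list ^^ k) [La] @ r"
    by blast
  have "(sigma_list ^^ Suc (Suc k)) [La] = sigma_list ((sigma_list ^^ k) [La] @ r)"
    using r(2) by simp
  also have "\<dots> = (sigma_list ^^ Suc k) [La] @ sigma_list r"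
    by (simp add: sigma_list_append)
  finally have eq: "(sigma_list ^^ Suc (Suc k)) [La] = (sigma_list ^^ Suc k) [La] @ sigma_list r" .
  have "sigma_list r \<noteq> []"
    using r(1) length_sigma_list[of r] by auto
  with eq show ?case by blast
qed

lemma length_iterate: "k < length ((sigma_list ^^ k) [La])"
proof (induction k)
  case (Suc k)
  obtain r where r: "r \<noteq> []" "(sigma_list ^^ Suc k) [La] = (sigma_list ^^ k) [La] @ r"
    using iterate_extends[of k] by blast
  then have "length (sigma_list ((sigma_list ^^ k) [La])) = length ((sigma_list ^^ k) [La]) + length r"
    by simp
  moreover have "length r > 0" using r(1) by simp
  ultimately have "Suc k < length (sigma_list ((sigma_list ^^ k) [La]))" using Suc by linarith
  then show ?case by simp
qed simp

lemma iterate_prefix: "\<exists>r. (sigma_list ^^ (k + j)) [La] = (sigma_list ^^ k) [La] @ r"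
proof (induction j)
  case (Suc j)
  then obtain r where "(sigma_list ^^ (k + j)) [La] = (sigma_list ^^ k) [La] @ r" by blast
  moreover obtain r' where "(sigma_list ^^ Suc (k + j)) [La] = (sigma_list ^^ (k + j)) [La] @ r'"
    using iterate_extends[of "k + j"] by blast
  ultimately show ?case
    by (metis add_Suc_right append_assoc)
qed simp

lemma iterate_nth:
  assumes "i < length ((sigma_list ^^ k) [La])" and "i < length ((sigma_list ^^ l) [La])"
  shows "(sigma_list ^^ k) [La] ! i = (sigma_list ^^ l) [La] ! i"
proof -
  have aux: "(sigma_list ^^ (a + j)) [La] ! i = (sigma_list ^^ a) [La] ! i"
    if "i < length ((sigma_list ^^ a) [La])" for a j
    using iterate_prefix[of a j] that by (auto simp: nth_append)
  show ?thesis
    using aux[of k "l - k"] aux[of l "k - l"] assms by (cases "k \<le> l") auto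
qed

lemma stream_eqI: "(\<And>i. s !! i = t !! i) \<Longrightarrow> s = t"
  using smap_alt[of id s t] by (simp add: stream.map_id)

lemma fixed_point_unique:
  assumes "sigma_stream s = s" and "shd s = La"
  shows "s !! i = (sigma_list ^^ i) [La] ! i"
proof -
  have "\<exists>t. s = (sigma_list ^^ k) [La] @- t" for k
  proof (induction k)
    case 0
    have "s = [La] @- stl s" using assms(2) by (cases s) auto
    then show ?case by auto
  next
    case (Suc k)
    then obtain t where t: "s = (sigma_list ^^ k) [La] @- t" by blast
    have "s = sigma_stream ((sigma_list ^^ k) [La] @- t)" using assms(1) t by metis
    then show ?case by (auto simp: sigma_stream_shift)
  qed
  then obtain t where t: "s = (sigma_list ^^ i) [La] @- t" by blast
  have "((sigma_list ^^ i) [La] @- t) !! i = (sigma_list ^^ i) [La] ! i"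
    using length_iterate[of i] by (simp only: shift_snth_less)
  with t show ?thesis by metis
qed

lemma fixed_point_ex1: "\<exists>!s. sigma_stream s = s \<and> shd s = La"
proof -
  define x where "x = smap (\<lambda>i. (sigma_list ^^ i) [La] ! i) nats"
  have nth: "x !! i = (sigma_list ^^ i) [La] ! i" for i
    by (simp add: x_def)
  have pre: "x = (sigma_list ^^ k) [La] @- sdrop (length ((sigma_list ^^ k) [La])) x" for k
  proof (rule stream_eqI)
    fix i
    show "x !! i = ((sigma_list ^^ k) [La] @- sdrop (length ((sigma_list ^^ k) [La])) x) !! i"
      using iterate_nth[of i i k] length_iterate[of i]
      by (auto simp: shift_snth sdrop_snth nth)
  qed
  have "sigma_stream x = x"
  proof (rule stream_eqI)
    fix i
    let ?u = "(sigma_list ^^ i) [La]"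
    have "sigma_stream x = sigma_list ?u @- sigma_stream (sdrop (length ?u) x)"
      using pre[of i] sigma_stream_shift by metis
    moreover have "i < length (sigma_list ?u)"
      using length_iterate[of i] length_sigma_list[of ?u] by linarith
    ultimately have "sigma_stream x !! i = (sigma_list ^^ Suc i) [La] ! i"
      by simp
    also have "\<dots> = x !! i"
      using iterate_nth[of i "Suc i" i] length_iterate[of i] \<open>i < length (sigma_list ?u)\<close>
      by (simp add: nth)
    finally show "sigma_stream x !! i = x !! i" .
  qed
  moreover have "shd x = La"
    using nth[of 0] by simp
  moreover have "s = t"
    if "sigma_stream s = s \<and> shd s = La" "sigma_stream t = t \<and> shd t = La" for s t
    using that fixed_point_unique by (metis stream_eqI)
  ultimately show ?thesis by blast
qed

lemma fibword_fixed_point: "sigma_stream fibword = fibword" "shd fibword = La"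
  using theI'[OF fixed_point_ex1] by (simp_all add: fibword_def)

section \<open>Occurrences and cubes\<close>

text \<open>Positions are 1-based, while \<^const>\<open>sdrop\<close> and \<^const>\<open>snth\<close> count from 0.\<close>

definition starts :: "letter list \<Rightarrow> nat set" where
  "starts w = {i. 1 \<le> i \<and> stake (length w) (sdrop (i - 1) fibword) = w}"

text \<open>The \<open>p\<close>-th occurrence of \<open>w\<close>, \<open>p = 1, 2, \<dots>\<close>, starts at position \<open>i\<close>.\<close>

definition occurrence_at :: "letter list \<Rightarrow> nat \<Rightarrow> nat \<Rightarrow> bool" where
  "occurrence_at w p i \<longleftrightarrow> i \<in> starts w \<and> card {j \<in> starts w. j \<le> i} = p"

text \<open>
  The occurrences \<open>p\<close>, \<open>p + 1\<close>, \<open>p + 2\<close> of \<open>w\<close> are adjacent and the last one ends at position \<open>n\<close>.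
  A word having an occurrence is automatically a factor.
\<close>

definition cube_ending_at :: "nat \<Rightarrow> letter list \<Rightarrow> nat \<Rightarrow> bool" where
  "cube_ending_at n w p \<longleftrightarrow> w \<noteq> [] \<and>
     (\<exists>i. occurrence_at w p i \<and>
          occurrence_at w (p + 1) (i + length w) \<and>
          occurrence_at w (p + 2) (i + 2 * length w) \<and>
          i + 3 * length w = n + 1)"

definition cube_count :: "nat \<Rightarrow> nat" where
  "cube_count n = card {(w, p). cube_ending_at n w p}"

lemma finite_cubes: "finite {(w, p). cube_ending_at n w p}"
proof (rule finite_subset)
  have "(UNIV :: letter set) = {La, Lb}"
    using letter.exhaust by auto
  then have "finite (UNIV :: letter set)"
    by (metis finite.emptyI finite.insertI)
  then show "finite ({w :: letter list. set w \<subseteq> UNIV \<and> length w \<le> n} \<times> {..n})"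
    using finite_lists_length_le by blast
  show "{(w, p). cube_ending_at n w p} \<subseteq> {w. set w \<subseteq> UNIV \<and> length w \<le> n} \<times> {..n}"
  proof clarsimp
    fix w p
    assume "cube_ending_at n w p"
    then obtain i where i: "w \<noteq> []" "occurrence_at w p i" "i + 3 * length w = n + 1"
      by (auto simp: cube_ending_at_def)
    have "p = card {j \<in> starts w. j \<le> i}"
      using i(2) by (simp add: occurrence_at_def)
    also have "\<dots> \<le> card {1..i}"
      by (rule card_mono) (auto simp: starts_def)
    finally have "p \<le> i" by simp
    moreover have "i \<ge> 1" using i(2) by (simp add: occurrence_at_def starts_def)
    moreover have "length w \<ge> 1" using i(1) by (cases w) auto
    ultimately show "length w \<le> n \<and> p \<le> n" using i(3) by linarith
  qed
qed

section \<open>Fibonacci numbers indexed from -2\<close>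

definition fnum :: "int \<Rightarrow> nat" where
  "fnum m = fib (nat (m + 2))"

lemma fnum_base: "fnum (-2) = 0" "fnum (-1) = 1"
  by (simp_all add: fnum_def)

lemma fnum_rec:
  assumes "m \<ge> -1"
  shows "fnum (m + 1) = fnum m + fnum (m - 1)"
proof -
  have "nat (m + 1 + 2) = Suc (Suc (nat (m + 1)))" "nat (m + 2) = Suc (nat (m + 1))"
    using assms by auto
  then show ?thesis by (simp add: fnum_def add.commute)
qed

section \<open>Integer vectors\<close>

text \<open>\<open>irange k l\<close> is the vector of all integers from \<open>k\<close> to \<open>l\<close>, both included.\<close>

definition irange :: "nat \<Rightarrow> nat \<Rightarrow> nat list" where
  "irange k l = [k..<Suc l]"

text \<open>Only meaningful for vectors of equal length, since \<^const>\<open>zip\<close> truncates.\<close>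

definition vec_add :: "nat list \<Rightarrow> nat list \<Rightarrow> nat list" where
  "vec_add u v = map2 (+) u v"

end

theory Submission
  imports Defs
begin

text \<open>
  The reason behind the theorem is a single periodicity. Write \<open>P = f\<^sub>m\<^sub>+\<^sub>3\<close>.
  The prefix of the Fibonacci word of length \<open>f\<^sub>m\<^sub>+\<^sub>5 - 2\<close> has period
  \<open>P\<close> (lemma \<open>fib_shift\<close>), and the theorem compares \<open>d(n)\<close> with
  \<open>d(n - P)\<close> for \<open>n\<close> at most that length. Translation by \<open>P\<close> identifies
  the cubes ending at \<open>n - P\<close> with the cubes ending at \<open>n\<close> that avoid the first
  \<open>P\<close> letters (\<open>cube_period_shift\<close>), so the correction vector counts the remaining
  cubes, those that begin inside the first \<open>P\<close> letters.

  Let \<open>L\<close> be the period of such a cube. The tool is the theorem of Fine and Wilf in the form of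
  lemma \<open>period_dvd\<close>: a region whose period \<open>p\<close> is primitive can overlap a region of
  period \<open>L\<close> in \<open>p + L\<close> or more letters only if \<open>p\<close> divides
  \<open>L\<close>. Two applications determine \<open>L\<close>. Against the prefix of period \<open>P\<close>, which is shorter than
  \<open>3 P\<close>, it gives \<open>2 L < P\<close>. Against the region \<open>R\<close> of period \<open>q
  = f\<^sub>m\<^sub>+\<^sub>1\<close> that extends from position \<open>f\<^sub>m\<^sub>+\<^sub>2 + 1\<close>
  to \<open>f\<^sub>m\<^sub>+\<^sub>4 + f\<^sub>m\<^sub>+\<^sub>1 - 2\<close> it gives \<open>q dvd L\<close>,
  whence \<open>L = q\<close> because \<open>P < 4 q\<close>. The region \<open>R\<close> cannot be extended
  in either direction, because the last two letters of the prefixes of length \<open>f\<^sub>j\<close>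
  alternate with the parity of \<open>j\<close> (\<open>fib_last_letter\<close>,
  \<open>fib_second_last_letter\<close>). Hence the cubes counted by the correction vector are exactly the
  cubes of period \<open>q\<close> inside \<open>R\<close> (a third application shows that consecutive occurrences
  of the repeated word are adjacent in them), one for each end position from
  \<open>f\<^sub>m\<^sub>+\<^sub>4 + f\<^sub>m\<^sub>-\<^sub>1\<close> to \<open>f\<^sub>m\<^sub>+\<^sub>4 +
  f\<^sub>m\<^sub>+\<^sub>1 - 2\<close>. Primitivity of \<open>P\<close> and \<open>q\<close> comes from
  letter counts: the prefix of length \<open>f\<^sub>j\<close> contains
  \<open>f\<^sub>j\<^sub>-\<^sub>1\<close> letters \<open>a\<close>, a number coprime to its length.
\<close>

section \<open>Periods of regions\<close>

text \<open>
  Regions are half-open intervals of indices counted from 0. A region of length at most \<open>p\<close> has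
  period \<open>p\<close> vacuously, so lower bounds on lengths appear as separate hypotheses below.
\<close>

definition has_period :: "(nat \<Rightarrow> 'a) \<Rightarrow> nat \<Rightarrow> nat \<Rightarrow> nat \<Rightarrow> bool" where
  "has_period s p x y \<longleftrightarrow> (\<forall>j. x \<le> j \<and> j + p < y \<longrightarrow> s j = s (j + p))"

lemma has_periodD: "has_period s p x y \<Longrightarrow> x \<le> j \<Longrightarrow> j + p < y \<Longrightarrow> s (j + p) = s j"
  by (simp add: has_period_def)

lemma has_period_mono: "has_period s p x y \<Longrightarrow> x \<le> u \<Longrightarrow> v \<le> y \<Longrightarrow> has_period s p u v"
  by (simp add: has_period_def)

lemma has_period_mult:
  assumes "has_period s p x y" "x \<le> j" "j + t * p < y"
  shows "s (j + t * p) = s j"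
  using assms(3)
proof (induction t)
  case (Suc t)
  then have "s ((j + t * p) + p) = s (j + t * p)"
    by (intro has_periodD[OF assms(1)]) (use assms(2) in \<open>auto simp: algebra_simps\<close>)
  with Suc show ?case by (simp add: algebra_simps)
qed simp

lemma has_period_cong:
  assumes "has_period s p x y" "x \<le> i" "i < y" "x \<le> j" "j < y" "i mod p = j mod p"
  shows "s i = s j"
proof -
  have *: "s i = s j" if le: "i \<le> j" and "x \<le> i" "j < y" "i mod p = j mod p" for i j
  proof -
    have "p dvd j - i" using that by (metis mod_eq_dvd_iff_nat)
    then obtain t where "j - i = t * p" by (metis dvd_def mult.commute)
    then have "j = i + t * p" using le by simp
    then show ?thesis using has_period_mult[OF assms(1), of i t] that by simp
  qed
  show ?thesis
  proof (cases "i \<le> j")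
    case True
    then show ?thesis using * assms by blast
  next
    case False
    then have "s j = s i" by (intro *) (use assms in auto)
    then show ?thesis by (rule sym)
  qed
qed

lemma ex_residue:
  assumes "0 < (p::nat)"
  shows "\<exists>j'. u \<le> j' \<and> j' < u + p \<and> j' mod p = j mod p"
proof (intro exI conjI)
  let ?r = "(j + p * u - u) mod p"
  have "u \<le> p * u" using assms by simp
  then have "u + (j + p * u - u) = j + p * u" by linarith
  then show "(u + ?r) mod p = j mod p" by (metis mod_add_right_eq mod_mult_self2)
qed (use assms in auto)

text \<open>
  Within a region of period \<open>p\<close>, all residue classes mod \<open>p\<close> are visible in any window of
  length \<open>p\<close>, so a divisor of \<open>p\<close> that is a period of the window is a period of the region.
\<close>

lemma has_period_extend:
  assumes "has_period s p x y" "has_period s g u v" "g dvd p" "0 < p"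
    and "x \<le> u" "v \<le> y" "u + p \<le> v"
  shows "has_period s g x y"
  unfolding has_period_def
proof (intro allI impI)
  fix j assume j: "x \<le> j \<and> j + g < y"
  obtain i where i: "u \<le> i" "i < u + p" "i mod p = j mod p"
    using ex_residue[OF assms(4)] by blast
  obtain i' where i': "u \<le> i'" "i' < u + p" "i' mod p = (j + g) mod p"
    using ex_residue[OF assms(4)] by blast
  have "i mod g = j mod g" using i(3) assms(3) by (metis mod_mod_cancel)
  also have "\<dots> = i' mod g" using i'(3) assms(3) by (metis mod_add_self2 mod_mod_cancel)
  finally have "s i = s i'" using has_period_cong[OF assms(2), of i i'] i i' assms(7) by simp
  moreover have "s i = s j" using has_period_cong[OF assms(1), of i j] i j assms by simp
  moreover have "s i' = s (j + g)"
    using has_period_cong[OF assms(1), of i' "j + g"] i' j assms by simp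
  ultimately show "s j = s (j + g)" by simp
qed

text \<open>
  A weak form of the theorem of Fine and Wilf, proved by the subtractive Euclidean algorithm:
  in a region of length at least \<open>p + q\<close> one can always step by \<open>p\<close> and by \<open>- q\<close> in one of
  the two orders, so that \<open>p - q\<close> is a period as well.
\<close>

lemma fine_wilf:
  assumes "has_period s p x y" "has_period s q x y" "x + p + q \<le> y" "0 < p" "0 < q"
  shows "has_period s (gcd p q) x y"
  using assms
proof (induction "p + q" arbitrary: p q rule: less_induct)
  case less
  have sub: "has_period s (p - q) x y"
    if "has_period s p x y" "has_period s q x y" "x + p + q \<le> y" "q < p" for p q
    unfolding has_period_def
  proof (intro allI impI)
    fix j assume j: "x \<le> j \<and> j + (p - q) < y"
    show "s j = s (j + (p - q))"
    proof (cases "j + p < y")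
      case True
      then have "s (j + p) = s j" by (intro has_periodD[OF that(1)]) (use j in auto)
      moreover have "s (j + (p - q) + q) = s (j + (p - q))"
        by (rule has_periodD[OF that(2)]) (use j True that(4) in auto)
      ultimately show ?thesis using that(4) by simp
    next
      case False
      then have jq: "x + q \<le> j" using that by linarith
      have "s (j - q + q) = s (j - q)" by (rule has_periodD[OF that(2)]) (use jq j in auto)
      moreover have "s (j - q + p) = s (j - q)"
        by (rule has_periodD[OF that(1)]) (use jq j that(4) in auto)
      ultimately show ?thesis using jq that(4) by simp
    qed
  qed
  consider "p = q" | "q < p" | "p < q" by linarith
  then show ?case
  proof cases
    case 1
    then show ?thesis using less.prems by simp
  next
    case 2
    have "has_period s (gcd (p - q) q) x y"
      by (rule less.hyps) (use 2 less.prems sub[of p q] in auto)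
    moreover have "gcd (p - q) q = gcd p q" using 2 by (simp add: gcd_diff1_nat)
    ultimately show ?thesis by simp
  next
    case 3
    have "has_period s (gcd (q - p) p) x y"
      by (rule less.hyps) (use 3 less.prems sub[of q p] in auto)
    moreover have "gcd (q - p) p = gcd p q" using 3 by (metis gcd_diff1_nat gcd.commute less_imp_le)
    ultimately show ?thesis by simp
  qed
qed

lemma period_dvd:
  assumes "has_period s p x y" "0 < p"
    and primitive: "\<And>g. g dvd p \<Longrightarrow> has_period s g x y \<Longrightarrow> g = p"
    and "has_period s l u v" "0 < l" "x \<le> u" "v \<le> y" "u + p + l \<le> v"
  shows "p dvd l"
proof -
  have "has_period s (gcd p l) u v"
    by (rule fine_wilf) (use assms has_period_mono[OF assms(1)] in auto)
  then have "has_period s (gcd p l) x y"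
    by (rule has_period_extend[OF assms(1)]) (use assms in auto)
  then have "gcd p l = p" by (intro primitive) auto
  then show ?thesis by (metis gcd_dvd2)
qed

section \<open>Shifts of the Fibonacci word by Fibonacci numbers\<close>

abbreviation F :: "nat \<Rightarrow> letter" where
  "F \<equiv> snth fibword"

lemma iterate_rec:
  "(sigma_list ^^ Suc (Suc k)) [La] = (sigma_list ^^ Suc k) [La] @ (sigma_list ^^ k) [La]"
proof (induction k)
  case 0
  show ?case by (simp add: sigma_list_def)
next
  case (Suc k)
  have "(sigma_list ^^ Suc (Suc (Suc k))) [La] = sigma_list ((sigma_list ^^ Suc (Suc k)) [La])"
    by simp
  also have "\<dots> = sigma_list ((sigma_list ^^ Suc k) [La] @ (sigma_list ^^ k) [La])"
    using Suc by simp
  finally show ?case by (simp add: sigma_list_append)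
qed

lemma length_iterate_fib: "length ((sigma_list ^^ k) [La]) = fib (k + 2)"
proof (induction k rule: fib.induct)
  case (3 n)
  have "length ((sigma_list ^^ Suc (Suc n)) [La])
      = length ((sigma_list ^^ Suc n) [La]) + length ((sigma_list ^^ n) [La])"
    by (simp only: iterate_rec length_append)
  then show ?case using 3 by simp
qed (simp_all add: sigma_list_def)

lemma F_iterate:
  assumes "i < fib (k + 2)"
  shows "F i = (sigma_list ^^ k) [La] ! i"
  using fixed_point_unique[OF fibword_fixed_point, of i] iterate_nth[of i i k]
    length_iterate[of i] assms by (simp add: length_iterate_fib)

lemma fib_shift_short:
  assumes "i < fib (k + 2)"
  shows "F (fib (k + 3) + i) = F i"
proof -
  have "fib (k + 3) + i < fib (Suc (Suc k) + 2)" using assms by (simp add: numeral_eq_Suc)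
  then have "F (fib (k + 3) + i) = (sigma_list ^^ Suc (Suc k)) [La] ! (fib (k + 3) + i)"
    by (rule F_iterate)
  also have "\<dots> = ((sigma_list ^^ Suc k) [La] @ (sigma_list ^^ k) [La]) ! (fib (k + 3) + i)"
    by (simp only: iterate_rec)
  also have "\<dots> = (sigma_list ^^ k) [La] ! i"
    using length_iterate_fib[of "Suc k"] by (simp add: nth_append numeral_eq_Suc)
  also have "\<dots> = F i" by (rule F_iterate[OF assms, symmetric])
  finally show ?thesis .
qed

text \<open>
  This is the near commutation of successive Fibonacci prefixes \<open>S\<close> and \<open>T\<close>: the words \<open>S T\<close> and
  \<open>T S\<close> agree except in their last two letters. The period
  \<open>fib (k + 2)\<close> of the prefix therefore persists up to length \<open>fib (k + 4) - 2\<close>, instead of the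
  length \<open>fib (k + 3)\<close> that follows from the recursion \<open>iterate_rec\<close> alone.
\<close>

lemma fib_shift:
  assumes "i + 2 < fib (k + 3)"
  shows "F (fib (k + 2) + i) = F i"
  using assms
proof (induction k arbitrary: i)
  case 0
  then show ?case by (simp add: numeral_eq_Suc)
next
  case (Suc k)
  have rec: "fib (k + 4) = fib (k + 3) + fib (k + 2)" by (simp add: numeral_eq_Suc)
  show ?case
  proof (cases "i < fib (k + 2)")
    case True
    then show ?thesis using fib_shift_short[of i k] by (simp add: numeral_eq_Suc)
  next
    case False
    define j where "j = i - fib (k + 2)"
    have i: "i = fib (k + 2) + j" using False by (simp add: j_def)
    have j: "j + 2 < fib (k + 3)" using Suc.prems rec i by (simp add: numeral_eq_Suc)
    have "F (fib (k + 3) + i) = F (fib (k + 4) + j)" by (simp add: rec i add.assoc)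
    also have "\<dots> = F j"
      using fib_shift_short[of j "Suc k"] j by (simp add: numeral_eq_Suc)
    also have "\<dots> = F i" using Suc.IH[OF j] i by simp
    finally show ?thesis by (simp add: numeral_eq_Suc)
  qed
qed

lemma fib_ge_2: "2 \<le> fib (k + 3)"
  using fib_mono[of 3 "k + 3"] by (simp add: numeral_eq_Suc)

lemma fib_suffix_letter:
  assumes "0 < c" "c \<le> 2"
  shows "F (fib (k + 5) - c) = F (fib (k + 3) - c)"
proof -
  have "fib (k + 5) - c = fib (k + 4) + (fib (k + 3) - c)"
    using fib_ge_2[of k] assms by (simp add: numeral_eq_Suc)
  moreover have "F (fib (k + 4) + (fib (k + 3) - c)) = F (fib (k + 3) - c)"
    using fib_shift_short[of "fib (k + 3) - c" "Suc k"] fib_ge_2[of k] assms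
    by (simp add: numeral_eq_Suc)
  ultimately show ?thesis by simp
qed

lemma F_0: "F 0 = La"
  using F_iterate[of 0 0] by simp

lemma F_1: "F 1 = Lb"
  using F_iterate[of 1 1] by (simp add: numeral_eq_Suc sigma_list_def)

lemma F_2: "F 2 = La"
  using F_iterate[of 2 2] by (simp add: numeral_eq_Suc sigma_list_def)

lemma fib_last_letter: "F (fib (k + 3) - 1) = La \<longleftrightarrow> odd k"
proof (induction k rule: induct_nat_012)
  case (ge2 n)
  have "Suc (Suc n) + 3 = n + 5" by simp
  then show ?case using fib_suffix_letter[of 1 n] ge2.IH(1) by (simp only:) simp
qed (use F_1 F_2 in \<open>simp_all add: numeral_eq_Suc\<close>)

lemma fib_second_last_letter: "F (fib (k + 3) - 2) = La \<longleftrightarrow> even k"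
proof (induction k rule: induct_nat_012)
  case (ge2 n)
  have "Suc (Suc n) + 3 = n + 5" by simp
  then show ?case using fib_suffix_letter[of 2 n] ge2.IH(1) by (simp only:) simp
qed (use F_0 F_1 in \<open>simp_all add: numeral_eq_Suc\<close>)

section \<open>Primitivity of the Fibonacci prefixes\<close>

definition count_a :: "nat \<Rightarrow> nat" where
  "count_a n = (\<Sum>i<n. of_bool (F i = La))"

lemma count_a_add:
  assumes "\<And>i. i < r \<Longrightarrow> F (n + i) = F i"
  shows "count_a (n + r) = count_a n + count_a r"
  using assms by (induction r) (auto simp: count_a_def)

lemma count_a_fib: "count_a (fib (k + 2)) = fib (k + 1)"
proof (induction k rule: fib.induct)
  case (3 n)
  have "count_a (fib (n + 3) + fib (n + 2)) = count_a (fib (n + 3)) + count_a (fib (n + 2))"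
    by (rule count_a_add) (rule fib_shift_short)
  then show ?case using 3 by (simp add: numeral_eq_Suc)
qed (use F_0 F_1 in \<open>simp_all add: count_a_def numeral_eq_Suc\<close>)

lemma count_a_mult:
  assumes "has_period F g 0 (r * g)"
  shows "count_a (r * g) = r * count_a g"
  using assms
proof (induction r)
  case (Suc r)
  have "F (r * g + i) = F i" if "i < g" for i
    using has_period_mult[OF Suc.prems, of i r] that by (simp add: add.commute)
  then have "count_a (r * g + g) = count_a (r * g) + count_a g" by (rule count_a_add)
  moreover have "has_period F g 0 (r * g)" by (rule has_period_mono[OF Suc.prems]) auto
  ultimately show ?case using Suc.IH by (simp add: add.commute)
qed (simp add: count_a_def)

text \<open>
  If the prefix were an \<open>r\<close>-th power, \<open>r\<close> would divide both its length and its number of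
  letters \<open>La\<close>, which are consecutive Fibonacci numbers.
\<close>

lemma fib_prefix_primitive:
  assumes "g dvd fib (k + 2)" "has_period F g 0 (fib (k + 2))"
  shows "g = fib (k + 2)"
proof -
  obtain r where r: "fib (k + 2) = r * g" using assms(1) by (metis dvd_def mult.commute)
  then have "fib (k + 1) = r * count_a g" using count_a_mult[of g r] assms(2) count_a_fib[of k] by simp
  then have "r dvd fib (k + 1)" "r dvd fib (k + 2)" using r by simp_all
  moreover have "coprime (fib (k + 1)) (fib (Suc (k + 1)))" by (rule coprime_fib_Suc_nat)
  ultimately have "is_unit r" by (metis coprime_common_divisor add_2_eq_Suc' add_Suc_right Suc_eq_plus1)
  then show ?thesis using r by simp
qed

section \<open>Cubes as periodic regions\<close>

text \<open>
  A cube with a given end is determined by its period \<open>L\<close>. The last conjunct says that the first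
  two occurrences of the repeated word are consecutive; by periodicity the last two are then
  consecutive as well.
\<close>

definition cube_period :: "nat \<Rightarrow> nat \<Rightarrow> bool" where
  "cube_period n L \<longleftrightarrow> 0 < L \<and> 3 * L \<le> n \<and> has_period F L (n - 3 * L) n \<and>
     (\<forall>s. 0 < s \<and> s < L \<longrightarrow> \<not> has_period F s (n - 3 * L) (n - 3 * L + L + s))"

lemma starts_iff: "Suc x \<in> starts w \<longleftrightarrow> (\<forall>j<length w. F (x + j) = w ! j)"
  by (auto simp: starts_def list_eq_iff_nth_eq sdrop_snth add.commute)

lemma starts_pos: "i \<in> starts w \<Longrightarrow> 0 < i"
  by (simp add: starts_def)

lemma card_starts_next:
  assumes "i + L \<in> starts w" "0 < L"
  shows "card {j \<in> starts w. j \<le> i + L} = card {j \<in> starts w. j \<le> i} + 1 \<longleftrightarrow>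
    (\<forall>s. 0 < s \<and> s < L \<longrightarrow> i + s \<notin> starts w)"
proof -
  have fin: "finite {j \<in> starts w. j \<le> i}" "finite {j \<in> starts w. i < j \<and> j < i + L}" by auto
  have eq: "{j \<in> starts w. j \<le> i + L} =
      insert (i + L) ({j \<in> starts w. j \<le> i} \<union> {j \<in> starts w. i < j \<and> j < i + L})"
    using assms by auto
  have "card ({j \<in> starts w. j \<le> i} \<union> {j \<in> starts w. i < j \<and> j < i + L}) =
      card {j \<in> starts w. j \<le> i} + card {j \<in> starts w. i < j \<and> j < i + L}"
    by (rule card_Un_disjoint) auto
  then have "card {j \<in> starts w. j \<le> i + L} =
      card {j \<in> starts w. j \<le> i} + card {j \<in> starts w. i < j \<and> j < i + L} + 1"
    unfolding eq using assms fin by (subst card_insert_disjoint) auto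
  moreover have "card {j \<in> starts w. i < j \<and> j < i + L} = 0 \<longleftrightarrow>
      (\<forall>s. 0 < s \<and> s < L \<longrightarrow> i + s \<notin> starts w)"
  proof -
    have "{j \<in> starts w. i < j \<and> j < i + L} = {} \<longleftrightarrow>
        (\<forall>s. 0 < s \<and> s < L \<longrightarrow> i + s \<notin> starts w)"
    proof
      show "\<forall>s. 0 < s \<and> s < L \<longrightarrow> i + s \<notin> starts w"
        if "{j \<in> starts w. i < j \<and> j < i + L} = {}"
      proof (intro allI impI notI)
        fix s assume "0 < s \<and> s < L" "i + s \<in> starts w"
        then have "i + s \<in> {j \<in> starts w. i < j \<and> j < i + L}" by simp
        then show False using that by blast
      qed
      show "{j \<in> starts w. i < j \<and> j < i + L} = {}"
        if *: "\<forall>s. 0 < s \<and> s < L \<longrightarrow> i + s \<notin> starts w"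
      proof safe
        fix j assume j: "j \<in> starts w" "i < j" "j < i + L"
        then have "i + (j - i) \<notin> starts w" using * by (intro *[rule_format]) auto
        then show "j \<in> {}" using j by simp
      qed
    qed
    then show ?thesis using fin by (simp only: card_0_eq)
  qed
  ultimately show ?thesis by (simp only: add_right_cancel add_cancel_left_right)
qed

text \<open>
  Since the distance may be smaller than the length of \<open>w\<close>, this also turns the absence of
  overlapping occurrences into a statement about periods.
\<close>

lemma starts_shift_iff:
  assumes "Suc x \<in> starts w"
  shows "Suc x + s \<in> starts w \<longleftrightarrow> has_period F s x (x + length w + s)"
proof
  assume "Suc x + s \<in> starts w"
  then have *: "\<forall>j<length w. F (x + s + j) = w ! j" using starts_iff[of "x + s" w] by simp
  show "has_period F s x (x + length w + s)"
    unfolding has_period_def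
  proof (intro allI impI)
    fix j assume j: "x \<le> j \<and> j + s < x + length w + s"
    then have "F (x + (j - x)) = w ! (j - x)" "F (x + s + (j - x)) = w ! (j - x)"
      using * assms by (auto simp only: starts_iff)
    then show "F j = F (j + s)" using j by (simp add: algebra_simps)
  qed
next
  assume per: "has_period F s x (x + length w + s)"
  have "F (x + s + j) = w ! j" if "j < length w" for j
    using has_periodD[OF per, of "x + j"] assms that by (simp add: starts_iff algebra_simps)
  then show "Suc x + s \<in> starts w" using starts_iff[of "x + s" w] by simp
qed

lemma cube_ending_at_imp_cube_period:
  assumes "cube_ending_at n w p"
  shows "cube_period n (length w)"
    and "w = stake (length w) (sdrop (n - 3 * length w) fibword)"
    and "p = card {j \<in> starts w. j \<le> Suc (n - 3 * length w)}"
proof -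
  define L x where "L = length w" and "x = n - 3 * L"
  obtain i where w: "w \<noteq> []" and i: "occurrence_at w p i" "occurrence_at w (p + 1) (i + L)"
      "occurrence_at w (p + 2) (i + 2 * L)" "i + 3 * L = n + 1"
    using assms by (auto simp: cube_ending_at_def L_def)
  have "0 < i" using i(1) starts_pos by (auto simp: occurrence_at_def)
  then have n: "3 * L \<le> n" and ix: "i = Suc x" using i(4) by (auto simp: x_def)
  have L: "0 < L" using w by (simp add: L_def)
  have s0: "Suc x \<in> starts w" and s1: "Suc x + L \<in> starts w" and s2: "Suc x + L + L \<in> starts w"
    using i ix by (simp_all add: occurrence_at_def mult_2 add.assoc)
  have per1: "has_period F L x (x + L + L)" using starts_shift_iff[OF s0, of L] s1 by (simp add: L_def)
  have per2: "has_period F L (x + L) (x + L + L + L)"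
    using starts_shift_iff[of "x + L" w L] s1 s2 by (simp add: L_def)
  have "has_period F L x n"
    unfolding has_period_def
  proof (intro allI impI)
    fix j assume j: "x \<le> j \<and> j + L < n"
    have n': "n = x + L + L + L" using n by (simp add: x_def)
    show "F j = F (j + L)"
      using has_periodD[OF per1, of j] has_periodD[OF per2, of j] j n'
      by (cases "j < x + L") auto
  qed
  moreover have "card {j \<in> starts w. j \<le> Suc x + L} = card {j \<in> starts w. j \<le> Suc x} + 1"
    using i ix by (simp add: occurrence_at_def)
  then have "\<forall>s. 0 < s \<and> s < L \<longrightarrow> Suc x + s \<notin> starts w"
    using card_starts_next[OF s1 L] by simp
  then have "\<forall>s. 0 < s \<and> s < L \<longrightarrow> \<not> has_period F s x (x + L + s)"
    using starts_shift_iff[OF s0] by (simp add: L_def)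
  ultimately show "cube_period n (length w)"
    using n L by (simp add: cube_period_def x_def L_def)
  show "w = stake (length w) (sdrop (n - 3 * length w) fibword)"
    using s0 by (simp add: starts_def x_def L_def)
  show "p = card {j \<in> starts w. j \<le> Suc (n - 3 * length w)}"
    using i(1) ix by (simp add: occurrence_at_def x_def L_def)
qed

lemma cube_period_imp_cube_ending_at:
  assumes "cube_period n L"
  shows "\<exists>w p. cube_ending_at n w p \<and> length w = L"
proof -
  define x w where "x = n - 3 * L" and "w = stake L (sdrop x fibword)"
  define p where "p = card {j \<in> starts w. j \<le> Suc x}"
  have L: "0 < L" "3 * L \<le> n" and per: "has_period F L x n"
    and cons: "\<And>s. 0 < s \<Longrightarrow> s < L \<Longrightarrow> \<not> has_period F s x (x + L + s)"
    using assms by (auto simp: cube_period_def x_def)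
  have n: "n = x + L + L + L" using L by (simp add: x_def)
  have len: "length w = L" by (simp add: w_def)
  have s0: "Suc x \<in> starts w" by (simp add: starts_def w_def)
  have s1: "Suc x + L \<in> starts w"
    using starts_shift_iff[OF s0, of L] has_period_mono[OF per, of x "x + L + L"] n
    by (simp add: len)
  have s2: "Suc x + L + L \<in> starts w"
    using starts_shift_iff[of "x + L" w L] has_period_mono[OF per, of "x + L" "x + L + L + L"] n s1
    by (simp add: len)
  have no1: "Suc x + s \<notin> starts w" if "0 < s" "s < L" for s
    using starts_shift_iff[OF s0, of s] cons[OF that] by (simp add: len)
  have no2: "Suc x + L + s \<notin> starts w" if s: "0 < s" "s < L" for s
  proof
    assume a: "Suc x + L + s \<in> starts w"
    have "has_period F s (x + L) (x + L + L + s)"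
      using starts_shift_iff[of "x + L" w s] s1 a by (simp add: len)
    then have "F (x + L + j + s) = F (x + L + j)" if "j < L" for j
      by (rule has_periodD) (use that in auto)
    moreover have "F (x + j + s + L) = F (x + j + s)" "F (x + j + L) = F (x + j)" if "j < L" for j
      by (rule has_periodD[OF per]; use that s n in simp)+
    moreover have "x + j + s + L = x + L + j + s" "x + j + L = x + L + j" for j by simp_all
    ultimately have *: "F (x + j + s) = F (x + j)" if "j < L" for j
      using that by simp
    have "has_period F s x (x + L + s)"
      unfolding has_period_def
    proof (intro allI impI)
      fix j assume j: "x \<le> j \<and> j + s < x + L + s"
      then have "j - x < L" by linarith
      from *[OF this] show "F j = F (j + s)" using j by simp
    qed
    then show False using cons[OF s] by simp
  qed
  have c1: "card {j \<in> starts w. j \<le> Suc x + L} = p + 1"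
    using card_starts_next[OF s1 L(1)] no1 by (simp add: p_def)
  have c2: "card {j \<in> starts w. j \<le> Suc x + L + L} = p + 2"
    using card_starts_next[OF s2 L(1)] no2 c1 by simp
  have "cube_ending_at n w p"
    unfolding cube_ending_at_def len
  proof (intro conjI exI[of _ "Suc x"])
    show "w \<noteq> []" using L len by auto
    show "occurrence_at w p (Suc x)" using s0 by (simp add: occurrence_at_def p_def)
    show "occurrence_at w (p + 1) (Suc x + L)" using s1 c1 by (simp add: occurrence_at_def)
    show "occurrence_at w (p + 2) (Suc x + 2 * L)"
      using s2 c2 by (simp add: occurrence_at_def mult_2 add.assoc)
    show "Suc x + 3 * L = n + 1" using n by simp
  qed
  then show ?thesis using len by blast
qed

lemma cube_count_eq: "cube_count n = card {L. cube_period n L}"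
proof -
  have "bij_betw (\<lambda>(w, p). length w) {(w, p). cube_ending_at n w p} {L. cube_period n L}"
    unfolding bij_betw_def
  proof
    show "inj_on (\<lambda>(w, p). length w) {(w, p). cube_ending_at n w p}"
    proof (rule inj_onI, clarify)
      fix w p w' p'
      assume *: "cube_ending_at n w p" "cube_ending_at n w' p'" "length w = length w'"
      have w: "w = w'"
        using cube_ending_at_imp_cube_period(2)[OF *(1)] cube_ending_at_imp_cube_period(2)[OF *(2)]
          *(3) by metis
      moreover have "p = p'"
        using cube_ending_at_imp_cube_period(3)[OF *(1)] cube_ending_at_imp_cube_period(3)[OF *(2)]
          w by simp
      ultimately show "w = w' \<and> p = p'" by simp
    qed
    show "(\<lambda>(w, p). length w) ` {(w, p). cube_ending_at n w p} = {L. cube_period n L}"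
      using cube_ending_at_imp_cube_period(1) cube_period_imp_cube_ending_at
      by (fastforce simp: image_iff)
  qed
  then show ?thesis by (simp add: cube_count_def bij_betw_same_card)
qed

lemma has_period_shift:
  assumes "has_period s P 0 n" "y + P \<le> n"
  shows "has_period s p (x + P) (y + P) \<longleftrightarrow> has_period s p x y"
proof -
  have P: "s (j + P) = s j" if "j < y" for j
    using has_periodD[OF assms(1), of j] that assms(2) by simp
  show ?thesis
  proof
    assume per: "has_period s p (x + P) (y + P)"
    show "has_period s p x y"
      unfolding has_period_def
    proof (intro allI impI)
      fix j assume j: "x \<le> j \<and> j + p < y"
      have "s (j + P + p) = s (j + P)" by (rule has_periodD[OF per]) (use j in auto)
      then show "s j = s (j + p)" using P[of j] P[of "j + p"] j by (simp add: add_ac)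
    qed
  next
    assume per: "has_period s p x y"
    show "has_period s p (x + P) (y + P)"
      unfolding has_period_def
    proof (intro allI impI)
      fix j assume j: "x + P \<le> j \<and> j + p < y + P"
      define i where "i = j - P"
      have i: "j = i + P" "x \<le> i" "i + p < y" using j by (auto simp: i_def)
      then have "s (i + p) = s i" by (intro has_periodD[OF per])
      moreover have "s (i + p + P) = s (i + p)" "s (i + P) = s i" using P i by auto
      ultimately show "s j = s (j + p)" using i by (simp add: add_ac)
    qed
  qed
qed

text \<open>
  Both parts of \<open>cube_period\<close> speak only about the letters of the cube itself, so cubes are
  preserved by translation along a period. The ordinal numbers of the occurrences do change,
  which is why cubes are described by \<open>L\<close> instead of by \<open>(w, p)\<close>.
\<close>

lemma cube_period_shift:
  assumes "has_period F P 0 n" "P \<le> n"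
  shows "cube_period (n - P) L \<longleftrightarrow> cube_period n L \<and> 3 * L \<le> n - P"
proof (cases "3 * L \<le> n - P")
  case True
  define x where "x = n - P - 3 * L"
  have nx: "n - 3 * L = x + P" "n = x + 3 * L + P" "n - P = x + 3 * L"
    using True assms(2) by (auto simp: x_def)
  have 1: "has_period F L (x + P) (x + 3 * L + P) \<longleftrightarrow> has_period F L x (x + 3 * L)"
    by (rule has_period_shift[OF assms(1)]) (use nx in auto)
  have 2: "has_period F s (x + P) (x + P + L + s) \<longleftrightarrow> has_period F s x (x + L + s)"
    if "s < L" for s
    using has_period_shift[OF assms(1), of "x + L + s" s x] nx that by (simp add: add_ac)
  show ?thesis using True 1 2 nx by (auto simp: cube_period_def)
next
  case False
  then show ?thesis by (auto simp: cube_period_def)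
qed

section \<open>The cubes that begin in the first period\<close>

text \<open>
  With \<open>f\<^sub>m\<^sub>-\<^sub>1 = fib k\<close>, this determines all cubes ending at \<open>n\<close> whose first letter is among the first
  \<open>P = fib (k + 4)\<close> letters. In \<open>a = fib k\<close> and \<open>b = fib (k + 1)\<close> all length
  comparisons become linear consequences of \<open>a \<le> b \<le> 2 a\<close>.
\<close>

lemma crossing_cube_iff:
  assumes k: "1 \<le> k" and n: "fib (k + 5) - 1 \<le> n" "n \<le> fib (k + 6) - 2"
  shows "cube_period n L \<and> n - fib (k + 4) < 3 * L \<longleftrightarrow>
    L = fib (k + 2) \<and> fib (k + 5) + fib k \<le> n \<and> n + 2 \<le> fib (k + 5) + fib (k + 2)"
proof -
  define a b where "a = fib k" and "b = fib (k + 1)"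
  define q P where "q = fib (k + 2)" and "P = fib (k + 4)"
  have fibs: "fib (k + 2) = a + b" "fib (k + 3) = a + 2 * b" "fib (k + 4) = 2 * a + 3 * b"
      "fib (k + 5) = 3 * a + 5 * b" "fib (k + 6) = 5 * a + 8 * b"
    by (simp_all add: a_def b_def numeral_eq_Suc)
  have qP: "q = a + b" "P = 2 * a + 3 * b" using fibs by (simp_all add: q_def P_def)
  have a: "1 \<le> a" using k fib_mono[of 1 k] by (simp add: a_def)
  have ab: "a \<le> b" using fib_mono[of k "k + 1"] by (simp add: a_def b_def)
  have ba: "b \<le> 2 * a"
  proof -
    obtain l where "k = Suc l" using k by (cases k) auto
    then show ?thesis using fib_mono[of l "Suc l"] by (simp add: a_def b_def)
  qed
  \<comment> \<open>The maximal region of period \<open>q\<close> is \<open>{x..<y}\<close>, with \<open>x = fib (k + 3)\<close> and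
      \<open>y = fib (k + 5) + fib (k + 2) - 2\<close>.\<close>
  define x where "x = a + 2 * b"
  define y where "y = 4 * a + 6 * b - 2"

  have idx: "k + 1 + 2 = k + 3" "k + 1 + 3 = k + 4" "k + 2 + 2 = k + 4" "k + 2 + 3 = k + 5"
      "k + 3 + 2 = k + 5" "k + 3 + 3 = k + 6"
    by simp_all
  note shift = fib_shift[of _ "k + 1", unfolded idx] fib_shift[of _ "k + 2", unfolded idx]
    fib_shift[of _ "k + 3", unfolded idx]
  have shiftP: "F (P + i) = F i" if "i + 2 < 3 * a + 5 * b" for i
    using shift(2)[of i] that fibs(4) by (simp add: P_def)
  have perP: "has_period F P 0 (5 * a + 8 * b - 2)"
    unfolding has_period_def using shiftP qP by (auto simp: add.commute)
  have primP: "g = P" if "g dvd P" "has_period F g 0 (5 * a + 8 * b - 2)" for g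
  proof -
    have "has_period F g 0 P" by (rule has_period_mono[OF that(2)]) (use qP a ab in auto)
    then show ?thesis using fib_prefix_primitive[of g "k + 2", unfolded idx] that(1)
      by (simp add: P_def)
  qed

  have perq: "has_period F q x y"
    unfolding has_period_def
  proof (intro allI impI)
    fix j assume j: "x \<le> j \<and> j + q < y"
    define i where "i = j - x"
    have i: "j = x + i" "i + 2 < 2 * a + 3 * b" using j qP by (auto simp: i_def x_def y_def)
    have "F (x + i) = F i"
      using shift(1)[of i] i fibs(2,3) by (simp add: x_def)
    moreover have "F (P + i) = F i" using shiftP i by simp
    moreover have "j + q = P + i" using i qP by (simp add: x_def)
    ultimately show "F j = F (j + q)" using i(1) by (simp only:)
  qed
  \<comment> \<open>The region contains a copy of the prefix of length \<open>q\<close>, starting at index \<open>P\<close>.\<close>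
  have primq: "g = q" if g: "g dvd q" "has_period F g x y" for g
  proof -
    have "q + P \<le> 5 * a + 8 * b - 2" using qP a ab by linarith
    then have "has_period F g (0 + P) (q + P) \<longleftrightarrow> has_period F g 0 q"
      by (rule has_period_shift[OF perP])
    moreover have "has_period F g (0 + P) (q + P)"
      by (rule has_period_mono[OF g(2)]) (use qP a ab in \<open>auto simp: x_def y_def\<close>)
    ultimately show ?thesis using fib_prefix_primitive[of g k] g(1) by (simp add: q_def)
  qed

  have left_max: "F (x - 1 + q) \<noteq> F (x - 1)"
  proof -
    have "Suc k + 3 = k + 4" by simp
    then have "x - 1 = fib (k + 3) - 1" "x - 1 + q = fib (Suc k + 3) - 1"
      using fibs(2,3) a qP by (simp_all only: x_def)
    then show ?thesis using fib_last_letter[of k] fib_last_letter[of "Suc k"] by auto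
  qed
  have right_max: "F (y - q + q) \<noteq> F (y - q)"
  proof -
    obtain l where l: "k = Suc l" using k by (cases k) auto
    have e: "y - q = fib (k + 5) - 2" "y - q + q = fib (k + 5) + (fib (k + 2) - 2)"
      using qP fibs a ab by (simp_all add: y_def)
    have "F (fib (k + 5) + (fib (k + 2) - 2)) = F (fib (k + 2) - 2)"
      by (rule shift(3)) (use fibs(1,5) a ab in linarith)
    moreover have "k + 2 = l + 3" "k + 5 = (l + 3) + 3" using l by simp_all
    ultimately have "F (y - q + q) = F (fib (l + 3) - 2)" "F (y - q) = F (fib ((l + 3) + 3) - 2)"
      using e by metis+
    then show ?thesis
      using fib_second_last_letter[of l] fib_second_last_letter[of "l + 3"]
      by (metis odd_add odd_numeral)
  qed

  have n': "P + x \<le> n + 1" "n \<le> 5 * a + 8 * b - 2" using n fibs qP by (simp_all add: x_def)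
  show ?thesis
  proof
    assume "cube_period n L \<and> n - fib (k + 4) < 3 * L"
    then have L: "0 < L" "3 * L \<le> n" "n < P + 3 * L" and per: "has_period F L (n - 3 * L) n"
      using n' a by (auto simp: cube_period_def P_def)
    \<comment> \<open>Otherwise the cube has length at least \<open>P + L\<close>, so \<open>P dvd L\<close>; but \<open>n < 3 * P\<close>.\<close>
    have small: "2 * L < P"
    proof (rule ccontr)
      assume "\<not> 2 * L < P"
      then have "P dvd L"
        by (intro period_dvd[OF perP _ primP per]) (use L n' qP a in auto)
      then have "P \<le> L" using L by (simp add: dvd_imp_le)
      then show False using L n' qP a ab by linarith
    qed
    \<comment> \<open>The overlap of the cube with the region of period \<open>q\<close> is long enough: the cube has to
        reach from the first \<open>P\<close> letters to \<open>n \<ge> P + x - 1\<close>, so \<open>3 * L \<ge> x\<close>, which bounds \<open>L\<close>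
        from below, while \<open>small\<close> bounds it from above.\<close>
    define u where "u = max (n - 3 * L) x"
    define v where "v = min n y"
    have uv: "u + q + L \<le> v"
      using small L n' qP a ab ba by (auto simp: u_def v_def x_def y_def)
    have "has_period F L u v" by (rule has_period_mono[OF per]) (auto simp: u_def v_def)
    then have "q dvd L"
      by (intro period_dvd[OF perq _ primq]) (use uv L qP a in \<open>auto simp: u_def v_def\<close>)
    then obtain r where r: "L = q * r" by blast
    have "L < q * 2" using small qP ab a by linarith
    then have "r < 2" using r by simp
    then have Lq: "L = q" using r L by (cases r) auto
    have "x \<le> n - 3 * q"
    proof (rule ccontr)
      assume "\<not> x \<le> n - 3 * q"
      then have "F (x - 1 + q) = F (x - 1)"
        by (intro has_periodD[OF per[unfolded Lq]]) (use Lq L n' qP a in auto)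
      then show False using left_max by simp
    qed
    moreover have "n \<le> y"
    proof (rule ccontr)
      assume "\<not> n \<le> y"
      then have "F (y - q + q) = F (y - q)"
        by (intro has_periodD[OF per[unfolded Lq]]) (use Lq L n' qP a ab in \<open>auto simp: y_def x_def\<close>)
      then show False using right_max by simp
    qed
    ultimately show "L = fib (k + 2) \<and> fib (k + 5) + fib k \<le> n \<and> n + 2 \<le> fib (k + 5) + fib (k + 2)"
      using Lq fibs qP L a ab by (auto simp: a_def[symmetric] x_def y_def)
  next
    assume "L = fib (k + 2) \<and> fib (k + 5) + fib k \<le> n \<and> n + 2 \<le> fib (k + 5) + fib (k + 2)"
    then have Lq: "L = q" and bounds: "4 * a + 5 * b \<le> n" "n + 2 \<le> 4 * a + 6 * b"
      using fibs by (auto simp: a_def[symmetric] q_def)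
    have xy: "x \<le> n - 3 * q" "n \<le> y" using bounds qP by (auto simp: x_def y_def)
    \<comment> \<open>An occurrence between the first two would make \<open>s\<close> a period of a region of length \<open>q + s\<close>, so that
        \<open>q dvd s\<close>, although \<open>0 < s < q\<close>.\<close>
    have "\<not> has_period F s (n - 3 * q) (n - 3 * q + q + s)" if s: "0 < s" "s < q" for s
    proof
      assume per: "has_period F s (n - 3 * q) (n - 3 * q + q + s)"
      have "q dvd s"
        by (rule period_dvd[OF perq _ primq per]) (use s xy bounds qP in auto)
      then show False using s by (simp add: dvd_imp_le leD)
    qed
    then have "cube_period n q"
      using has_period_mono[OF perq xy] bounds qP a by (simp add: cube_period_def)
    then show "cube_period n L \<and> n - fib (k + 4) < 3 * L"
      using Lq bounds fibs qP a ab by auto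
  qed
qed

lemma cube_count_shift:
  assumes k: "1 \<le> k" and n: "fib (k + 5) - 1 \<le> n" "n \<le> fib (k + 6) - 2"
  shows "cube_count n = cube_count (n - fib (k + 4)) +
    of_bool (fib (k + 5) + fib k \<le> n \<and> n + 2 \<le> fib (k + 5) + fib (k + 2))"
proof -
  let ?P = "fib (k + 4)"
  let ?B = "{L. cube_period n L \<and> n - ?P < 3 * L}"
  have idx: "k + 2 + 2 = k + 4" "k + 2 + 3 = k + 5" by simp_all
  have "has_period F ?P 0 n"
    unfolding has_period_def
  proof (intro allI impI)
    fix j assume "0 \<le> j \<and> j + ?P < n"
    then have "j + 2 + fib (k + 4) < fib (k + 6)" using n(2) by linarith
    also have "fib (k + 6) = fib (k + 5) + fib (k + 4)" by (simp add: numeral_eq_Suc)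
    finally show "F j = F (j + ?P)" using fib_shift[of j "k + 2", unfolded idx] by (simp add: add.commute)
  qed
  moreover have "?P \<le> n"
    using n(1) fib_mono[of 1 "k + 3"] by (simp add: numeral_eq_Suc)
  ultimately have "{L. cube_period n L} = {L. cube_period (n - ?P) L} \<union> ?B"
    by (auto simp: cube_period_shift)
  moreover have "{L. cube_period (n - ?P) L} \<inter> ?B = {}"
    by (auto simp: cube_period_def)
  moreover have "finite {L. cube_period (n - ?P) L}"
    by (rule finite_subset[of _ "{..n}"]) (auto simp: cube_period_def)
  moreover have "finite ?B"
    by (rule finite_subset[of _ "{..n}"]) (auto simp: cube_period_def)
  ultimately have "cube_count n = cube_count (n - ?P) + card ?B"
    by (simp add: cube_count_eq card_Un_disjoint)
  moreover have "card ?B = of_bool (fib (k + 5) + fib k \<le> n \<and> n + 2 \<le> fib (k + 5) + fib (k + 2))"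
    unfolding crossing_cube_iff[OF k n] by auto
  ultimately show ?thesis by simp
qed

theorem mainTheorem5:
  fixes m :: int
  assumes "m \<ge> 3"
  shows "map cube_count (irange (fnum (m + 4) - 1) (fnum (m + 5) - 2)) =
    vec_add
      (map cube_count (irange (fnum (m + 2) - 1) (fnum (m + 3) - 2)
                     @ irange (fnum (m + 3) - 1) (fnum (m + 4) - 2)))
      (replicate (fnum (m - 1) + 1) 0 @ replicate (fnum m - 1) 1 @ replicate (fnum (m + 2)) 0)"
proof -
  define k where "k = nat (m + 1)"
  have k: "4 \<le> k" using assms by (simp add: k_def)
  have idx: "nat (m - 1 + 2) = k" "nat (m + 2) = k + 1" "nat (m + 2 + 2) = k + 3"
      "nat (m + 3 + 2) = k + 4" "nat (m + 4 + 2) = k + 5" "nat (m + 5 + 2) = k + 6"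
    using assms by (auto simp: k_def)
  define a b where "a = fib k" and "b = fib (k + 1)"
  have fibs: "fib (k + 2) = a + b" "fib (k + 3) = a + 2 * b" "fib (k + 4) = 2 * a + 3 * b"
      "fib (k + 5) = 3 * a + 5 * b" "fib (k + 6) = 5 * a + 8 * b"
    by (simp_all add: a_def b_def numeral_eq_Suc)
  have fnums: "fnum (m - 1) = a" "fnum m = b" "fnum (m + 2) = a + 2 * b"
      "fnum (m + 3) = 2 * a + 3 * b" "fnum (m + 4) = 3 * a + 5 * b" "fnum (m + 5) = 5 * a + 8 * b"
    unfolding fnum_def idx fibs by (simp_all only: a_def b_def)
  have a: "3 \<le> a" "3 \<le> b"
    using fib_mono[of 4 k] fib_mono[of 4 "k + 1"] k by (simp_all add: a_def b_def numeral_eq_Suc)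
  have count: "cube_count n = cube_count (n - (2 * a + 3 * b)) +
      of_bool (4 * a + 5 * b \<le> n \<and> n + 2 \<le> 4 * a + 6 * b)"
    if "3 * a + 5 * b - 1 \<le> n" "n \<le> 5 * a + 8 * b - 2" for n
    using cube_count_shift[of k n] that k fibs by (simp add: a_def[symmetric])
  have "Suc (2 * a + 3 * b - 2) = 2 * a + 3 * b - 1"
      "Suc (3 * a + 5 * b - 2) = 2 * a + 3 * b - 1 + (a + 2 * b)"
    using a by simp_all
  then have "irange (a + 2 * b - 1) (2 * a + 3 * b - 2) @
      irange (2 * a + 3 * b - 1) (3 * a + 5 * b - 2) = irange (a + 2 * b - 1) (3 * a + 5 * b - 2)"
    unfolding irange_def by (simp only:) (rule upt_add_eq_append[symmetric], simp)
  then show ?thesis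
    unfolding fnums
  proof (simp only:, intro nth_equalityI)
    let ?l = "irange (3 * a + 5 * b - 1) (5 * a + 8 * b - 2)"
    let ?r = "irange (a + 2 * b - 1) (3 * a + 5 * b - 2)"
    let ?v = "replicate (a + 1) 0 @ replicate (b - 1) 1 @ replicate (a + 2 * b) (0::nat)"
    have len: "length ?l = 2 * a + 3 * b" "length ?r = 2 * a + 3 * b" "length ?v = 2 * a + 3 * b"
      using a by (auto simp: irange_def simp del: upt_Suc)
    then show "length (map cube_count ?l) = length (vec_add (map cube_count ?r) ?v)"
      by (simp add: vec_add_def)
    fix i assume "i < length (map cube_count ?l)"
    then have i: "i < 2 * a + 3 * b" using len by simp
    define n where "n = 3 * a + 5 * b - 1 + i"
    have n': "?l ! i = n" "?r ! i = n - (2 * a + 3 * b)"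
      using i a by (auto simp: irange_def n_def simp del: upt_Suc)
    have v: "?v ! i = of_bool (4 * a + 5 * b \<le> n \<and> n + 2 \<le> 4 * a + 6 * b)"
      using i a by (auto simp: nth_append n_def simp del: replicate_Suc)
    have "map cube_count ?l ! i = cube_count n"
      using i len n' by simp
    also have "\<dots> = cube_count (n - (2 * a + 3 * b)) + ?v ! i"
      unfolding v by (rule count) (use i a in \<open>auto simp: n_def\<close>)
    also have "\<dots> = vec_add (map cube_count ?r) ?v ! i"
      using i len n' by (simp add: vec_add_def del: replicate_Suc)
    finally show "map cube_count ?l ! i = vec_add (map cube_count ?r) ?v ! i" .
  qed
qed

end
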